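(* Suppose $n$ is odd and $\mathcal{O}$ is a rowmotion orbit of interval-closed sets of $[2]\times[n]$ of size $n+5$ or $(n+5)/3$. Then $\frac{1}{|\mathcal{O}|}\sum_{I\in\mathcal{O}}\mathrm{sc}(I)=0$.
   Context: $[2]\times[n]=\{(i,j): i\in\{1,2\},1\le j\le n\}$ with the componentwise order. An interval-closed set (ICS) is a subset $I$ with $x,y\in I$, $x\le z\le y\Rightarrow z\in I$. The toggle $t_x$ sends $I$ to $I\triangle\{x\}$ if this is an ICS, and to $I$ otherwise; rowmotion is $\mathrm{Row}=t_{x_1}\circ\cdots\circ t_{x_N}$ for any linear extension $x_1,\dots,x_N$ (toggles applied top to bottom). The rank of $(i,j)$ is $i+j-2$; $\mathrm{sc}(x)=(-1)^{\mathrm{rank}(x)}$ and $\mathrm{sc}(I)=\sum_{x\in I}\mathrm{sc}(x)$. *)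

theory Defs
  imports Complex_Main "HOL-Library.Product_Order" "HOL-Combinatorics.Orbits"
begin

text \<open>Pairs are ordered componentwise here, and a poset is a set with the order of its type.\<close>

definition two_by :: "nat \<Rightarrow> (nat \<times> nat) set" where
  "two_by n = {1, 2} \<times> {1..n}"

definition interval_closed :: "'a::order set \<Rightarrow> 'a set \<Rightarrow> bool" where
  "interval_closed P I \<longleftrightarrow> I \<subseteq> P \<and> (\<forall>x\<in>I. \<forall>y\<in>I. \<forall>z\<in>P. x \<le> z \<and> z \<le> y \<longrightarrow> z \<in> I)"

definition toggle :: "'a::order set \<Rightarrow> 'a \<Rightarrow> 'a set \<Rightarrow> 'a set" where
  "toggle P x I = (if interval_closed P (sym_diff I {x}) then sym_diff I {x} else I)"

definition linear_extension :: "'a::order set \<Rightarrow> 'a list \<Rightarrow> bool" where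
  "linear_extension P xs \<longleftrightarrow> distinct xs \<and> set xs = P \<and>
     (\<forall>i<length xs. \<forall>j<length xs. xs ! i < xs ! j \<longrightarrow> i < j)"

text \<open>For \<open>xs = [x\<^sub>1, \<dots>, x\<^sub>N]\<close> this is \<open>t\<^bsub>x\<^sub>1\<^esub> \<circ> \<dots> \<circ> t\<^bsub>x\<^sub>N\<^esub>\<close>: the last (topmost)
  element is toggled first. The linear extension is kept as a parameter, so that statements
  about rowmotion can be made for every linear extension.\<close>

definition rowmotion :: "'a::order set \<Rightarrow> 'a list \<Rightarrow> 'a set \<Rightarrow> 'a set" where
  "rowmotion P xs = foldr (toggle P) xs"

text \<open>\<^const>\<open>orbit\<close> collects the forward iterates with positive exponent; since rowmotion
  permutes the finite set of interval-closed sets, this is the full orbit of \<open>I\<close>, including \<open>I\<close>.\<close>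

definition rowmotion_orbits :: "'a::order set \<Rightarrow> 'a list \<Rightarrow> 'a set set set" where
  "rowmotion_orbits P xs = {orbit (rowmotion P xs) I | I. interval_closed P I}"

text \<open>On \<^term>\<open>two_by n\<close> both coordinates are at least 1, so the subtraction is not truncated.\<close>

definition grid_rank :: "nat \<times> nat \<Rightarrow> nat" where
  "grid_rank x = fst x + snd x - 2"

definition signed_card :: "(nat \<times> nat) set \<Rightarrow> int" where
  "signed_card I = (\<Sum>x\<in>I. (-1) ^ grid_rank x)"

end

theory Submission
  imports Defs
begin

text \<open>
  An interval-closed set of \<open>[2] \<times> [n]\<close> consists of one interval in each row, so rowmotion is a piecewise
  translation of at most four endpoints. For odd \<open>n\<close> we look for a potential, depending only on the parities
  of the endpoints, whose increment along rowmotion is a multiple of the signed cardinality; it forces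
  the orbit sums to vanish. Such a potential exists on the family called \<open>loose\<close> below. Orbits of the
  other family repeatedly visit sets \<open>{1} \<times> [x, y)\<close>. As long as \<open>y - x \<ge> 4\<close>, the first return map permutes
  \<open>(x, y - x, n + 5 - y)\<close> cyclically, the return times add up to \<open>n + 5\<close>, and a parity
  potential exists as well. If \<open>y - x \<le> 3\<close> then \<open>n + 5\<close> is not a period, so this does not happen in the
  orbits of size \<open>n + 5\<close> or \<open>(n + 5) / 3\<close>.
\<close>

section \<open>A local criterion for rowmotion\<close>

text \<open>Describes the moment at which \<open>x\<close> is toggled: \<open>foldr\<close> has
  already handled \<open>zs\<close>, which contains all of \<open>P\<close> above \<open>x\<close>
  and nothing below it.\<close>

lemma linear_extension_split:
  assumes "linear_extension P (ys @ x # zs)"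
  shows "x \<in> P" "x \<notin> set zs" "\<And>y. y \<in> P \<Longrightarrow> x < y \<Longrightarrow> y \<in> set zs" "\<And>y. y \<in> set zs \<Longrightarrow> \<not> y < x"
proof -
  let ?xs = "ys @ x # zs" and ?m = "length ys"
  have d: "distinct ?xs" and s: "set ?xs = P"
    and o: "\<And>i j. i < length ?xs \<Longrightarrow> j < length ?xs \<Longrightarrow> ?xs ! i < ?xs ! j \<Longrightarrow> i < j"
    using assms unfolding linear_extension_def by auto
  show "x \<in> P" "x \<notin> set zs" using d s by auto
  have m: "?xs ! ?m = x" "?m < length ?xs" by simp_all
  show "y \<in> set zs" if y: "y \<in> P" "x < y" for y
  proof -
    have "y \<notin> set ys"
    proof
      assume "y \<in> set ys"
      then obtain i where "i < ?m" "ys ! i = y" by (auto simp: in_set_conv_nth)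
      then show False using o[of ?m i] m y by (auto simp: nth_append)
    qed
    then show ?thesis using y s by auto
  qed
  show "\<not> y < x" if "y \<in> set zs" for y
  proof
    assume "y < x"
    from that obtain i where "i < length zs" "zs ! i = y" by (auto simp: in_set_conv_nth)
    then show False using o[of "Suc (?m + i)" ?m] m \<open>y < x\<close> by (auto simp: nth_append)
  qed
qed

text \<open>\<open>K\<close> is already interval-closed, so deleting \<open>x\<close> can only
  create a violation whose middle element is \<open>x\<close>.\<close>

lemma interval_closed_remove_iff:
  assumes "interval_closed P K" "x \<in> K"
  shows "interval_closed P (K - {x}) \<longleftrightarrow> \<not> ((\<exists>k\<in>K. k < x) \<and> (\<exists>k\<in>K. x < k))"
    (is "?l \<longleftrightarrow> ?r")
proof
  assume l: ?l
  have "x \<in> P" using assms unfolding interval_closed_def by blast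
  show ?r
  proof (intro notI, elim conjE bexE)
    fix k k' assume "k \<in> K" "k < x" "k' \<in> K" "x < k'"
    then have "k \<in> K - {x}" "k' \<in> K - {x}" "k \<le> x" "x \<le> k'" by auto
    then have "x \<in> K - {x}" using l \<open>x \<in> P\<close> unfolding interval_closed_def by blast
    then show False by simp
  qed
next
  assume r: ?r
  have "z \<in> K - {x}" if "k \<in> K - {x}" "k' \<in> K - {x}" "z \<in> P" "k \<le> z" "z \<le> k'" for k z k'
  proof -
    have "z \<in> K" using that assms(1) unfolding interval_closed_def by blast
    moreover have "z \<noteq> x" using that r by (metis DiffE insertI1 order.order_iff_strict)
    ultimately show ?thesis by simp
  qed
  moreover have "K \<subseteq> P" using assms(1) unfolding interval_closed_def by blast
  ultimately show ?l unfolding interval_closed_def by blast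
qed

text \<open>Adding \<open>x\<close> can only create violations in which \<open>x\<close> is the
  lower or the upper end, whence the two conjuncts.\<close>

lemma interval_closed_insert_iff:
  assumes "interval_closed P K" "x \<in> P" "x \<notin> K"
  shows "interval_closed P (insert x K) \<longleftrightarrow>
    (\<forall>k\<in>K. \<forall>z\<in>P. x < z \<and> z < k \<longrightarrow> z \<in> K) \<and> (\<forall>k\<in>K. \<forall>z\<in>P. k < z \<and> z < x \<longrightarrow> z \<in> K)"
  (is "?l \<longleftrightarrow> ?r")
proof
  assume ?l
  then have *: "z \<in> insert x K" if "k \<in> insert x K" "k' \<in> insert x K" "z \<in> P" "k \<le> z" "z \<le> k'" for k z k'
    using that unfolding interval_closed_def by blast
  show ?r using * less_imp_le less_irrefl by blast
next
  assume r: ?r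
  have *: "z \<in> K" if "k \<in> K" "k' \<in> K" "z \<in> P" "k \<le> z" "z \<le> k'" for k z k'
    using that assms(1) unfolding interval_closed_def by blast
  have "z \<in> insert x K" if "k \<in> insert x K" "k' \<in> insert x K" "z \<in> P" "k \<le> z" "z \<le> k'" for k z k'
    using that r * by (metis insert_iff order.antisym order.order_iff_strict)
  moreover have "K \<subseteq> P" using assms(1) unfolding interval_closed_def by blast
  ultimately show ?l using assms(2) unfolding interval_closed_def by blast
qed

text \<open>When \<open>x\<close> is toggled, everything above it has its new state and everything below it its old one,
  and elements incomparable to \<open>x\<close> do not matter. Hence one criterion serves all linear extensions.\<close>

lemma rowmotion_eqI:
  assumes lin: "linear_extension P xs" and I: "interval_closed P I" and J: "J \<subseteq> P"
    and rule: "\<And>x. x \<in> P \<Longrightarrow> x \<in> J \<longleftrightarrow>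
      (if x \<in> I then (\<exists>k\<in>I. k < x) \<and> (\<exists>k\<in>J. x < k)
       else (\<forall>k\<in>J. \<forall>z\<in>P. x < z \<and> z < k \<longrightarrow> z \<in> J) \<and> (\<forall>k\<in>I. \<forall>z\<in>P. k < z \<and> z < x \<longrightarrow> z \<in> I))"
  shows "rowmotion P xs I = J"
proof -
  have IP: "I \<subseteq> P" using I by (simp add: interval_closed_def)
  \<comment> \<open>Induction over the suffixes \<open>zs\<close> of \<open>xs\<close>: once
    \<open>zs\<close> has been processed, the state agrees with \<open>J\<close> on
    \<open>zs\<close> and still with \<open>I\<close> elsewhere.\<close>
  have "interval_closed P (J \<inter> set zs \<union> (I - set zs)) \<and>
      foldr (toggle P) zs I = J \<inter> set zs \<union> (I - set zs)" if "xs = ys @ zs" for ys zs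
    using that
  proof (induction zs arbitrary: ys)
    case Nil
    then show ?case using I by simp
  next
    case (Cons x zs)
    define K where "K = J \<inter> set zs \<union> (I - set zs)"
    have K: "interval_closed P K" "foldr (toggle P) zs I = K"
      using Cons.IH[of "ys @ [x]"] Cons.prems unfolding K_def by auto
    note x = linear_extension_split[OF lin[unfolded Cons.prems]]
    have up: "y \<in> K \<longleftrightarrow> y \<in> J" if "x < y" for y
      using x(3) that J IP unfolding K_def by blast
    have dn: "y \<in> K \<longleftrightarrow> y \<in> I" if "y \<le> x" for y
      using x(2,4) that unfolding K_def by (auto simp: order.order_iff_strict)
    have xK: "x \<in> K \<longleftrightarrow> x \<in> I" using dn by simp
    \<comment> \<open>The toggle takes effect exactly when \<open>I\<close> and \<open>J\<close>
      differ at \<open>x\<close>. This is \<open>rule\<close> at \<open>x\<close>, with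
      \<open>K\<close> replaced by \<open>J\<close> above \<open>x\<close> and by \<open>I\<close>
      below it.\<close>
    have *: "interval_closed P (sym_diff K {x}) \<longleftrightarrow> (x \<in> K \<longleftrightarrow> x \<notin> J)"
    proof (cases "x \<in> K")
      case True
      then have eq: "sym_diff K {x} = K - {x}" by auto
      have below: "(\<exists>k\<in>K. k < x) \<longleftrightarrow> (\<exists>k\<in>I. k < x)" using dn less_imp_le by blast
      have above: "(\<exists>k\<in>K. x < k) \<longleftrightarrow> (\<exists>k\<in>J. x < k)" using up by blast
      show ?thesis
        unfolding eq interval_closed_remove_iff[OF K(1) True] below above
        using rule[OF x(1)] True xK by simp
    next
      case False
      then have eq: "sym_diff K {x} = insert x K" by auto
      have above: "(\<forall>k\<in>K. \<forall>z\<in>P. x < z \<and> z < k \<longrightarrow> z \<in> K) \<longleftrightarrow>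
          (\<forall>k\<in>J. \<forall>z\<in>P. x < z \<and> z < k \<longrightarrow> z \<in> J)"
        using up by (meson less_trans)
      have below: "(\<forall>k\<in>K. \<forall>z\<in>P. k < z \<and> z < x \<longrightarrow> z \<in> K) \<longleftrightarrow>
          (\<forall>k\<in>I. \<forall>z\<in>P. k < z \<and> z < x \<longrightarrow> z \<in> I)"
        using dn by (meson less_trans less_imp_le)
      show ?thesis
        unfolding eq interval_closed_insert_iff[OF K(1) x(1) False] below above
        using rule[OF x(1)] False xK by argo
    qed
    have "toggle P x K = J \<inter> set (x # zs) \<union> (I - set (x # zs))"
    proof -
      have "toggle P x K = (if x \<in> J then insert x K else K - {x})"
        unfolding toggle_def * by auto
      then show ?thesis using x(2) unfolding K_def by auto
    qed
    moreover have "interval_closed P (toggle P x K)" using K(1) unfolding toggle_def by simp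
    ultimately show ?case using K(2) by simp
  qed
  from this[of "[]" xs] have "rowmotion P xs I = J \<inter> set xs \<union> (I - set xs)"
    unfolding rowmotion_def by simp
  moreover have "set xs = P" using lin unfolding linear_extension_def by blast
  ultimately show ?thesis using J IP by auto
qed

section \<open>Coordinates: one interval in each row\<close>

text \<open>The half-open interval \<open>[c, d)\<close> in the top row \<open>i = 2\<close> and \<open>[a, b)\<close> in the bottom row \<open>i = 1\<close>;
  empty rows are encoded by \<open>0 0\<close>.\<close>

definition seg :: "nat \<Rightarrow> nat \<Rightarrow> nat \<Rightarrow> nat \<Rightarrow> (nat \<times> nat) set" where
  "seg c d a b = {2} \<times> {c..<d} \<union> {1} \<times> {a..<b}"

lemma seg_iff [simp]:
  "(i, j) \<in> seg c d a b \<longleftrightarrow> i = 2 \<and> c \<le> j \<and> j < d \<or> i = 1 \<and> a \<le> j \<and> j < b"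
  by (auto simp: seg_def)

lemma pair_less_iff: "((i::nat), (j::nat)) < (k, l) \<longleftrightarrow> i \<le> k \<and> j < l \<or> i < k \<and> j \<le> l"
  by (auto simp: less_le_not_le)

lemma Bex_seg: "(\<exists>k\<in>seg c d a b. Q k) \<longleftrightarrow> (\<exists>j. c \<le> j \<and> j < d \<and> Q (2, j)) \<or> (\<exists>j. a \<le> j \<and> j < b \<and> Q (1, j))"
  by (auto simp: seg_def)

lemma Ball_seg: "(\<forall>k\<in>seg c d a b. Q k) \<longleftrightarrow> (\<forall>j. c \<le> j \<longrightarrow> j < d \<longrightarrow> Q (2, j)) \<and> (\<forall>j. a \<le> j \<longrightarrow> j < b \<longrightarrow> Q (1, j))"
  by (auto simp: seg_def)

lemma Ball_two_by: "(\<forall>k\<in>two_by n. Q k) \<longleftrightarrow> (\<forall>j. 1 \<le> j \<longrightarrow> j \<le> n \<longrightarrow> Q (1, j) \<and> Q (2, j))"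
  by (auto simp: two_by_def)

lemma seg_subset_two_by_iff:
  "seg c d a b \<subseteq> two_by n \<longleftrightarrow> (c < d \<longrightarrow> 1 \<le> c \<and> d \<le> n + 1) \<and> (a < b \<longrightarrow> 1 \<le> a \<and> b \<le> n + 1)"
    (is "?l \<longleftrightarrow> ?r")
proof
  assume l: ?l
  have *: "1 \<le> j \<and> j \<le> n" if "(i, j) \<in> seg c d a b" for i j
    using subsetD[OF l that] by (auto simp: two_by_def)
  have "1 \<le> c \<and> d \<le> n + 1" if "c < d"
  proof -
    have "(2, c) \<in> seg c d a b" "(2, d - 1) \<in> seg c d a b" using that by auto
    from this[THEN *] show ?thesis by auto
  qed
  moreover have "1 \<le> a \<and> b \<le> n + 1" if "a < b"
  proof -
    have "(1, a) \<in> seg c d a b" "(1, b - 1) \<in> seg c d a b" using that by auto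
    from this[THEN *] show ?thesis by auto
  qed
  ultimately show ?r by blast
next
  assume ?r
  then show ?l by (auto simp: two_by_def seg_def)
qed

lemma between_two_by:
  assumes "1 \<le> j" "k \<le> n"
  shows "(\<forall>z\<in>two_by n. (2, j) < z \<and> z < (2, k) \<longrightarrow> Q z) \<longleftrightarrow> (\<forall>z. j < z \<and> z < k \<longrightarrow> Q (2, z))"
    and "(\<forall>z\<in>two_by n. (1, j) < z \<and> z < (1, k) \<longrightarrow> Q z) \<longleftrightarrow> (\<forall>z. j < z \<and> z < k \<longrightarrow> Q (1, z))"
    and "(\<forall>z\<in>two_by n. (1, j) < z \<and> z < (2, k) \<longrightarrow> Q z) \<longleftrightarrow>
      (\<forall>z. j < z \<and> z \<le> k \<longrightarrow> Q (1, z)) \<and> (\<forall>z. j \<le> z \<and> z < k \<longrightarrow> Q (2, z))"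
  using assms unfolding Ball_two_by pair_less_iff by auto

lemma not_between_top_bottom: "\<not> ((2::nat, j::nat) < z \<and> z < (1, k))"
  by (cases z) (auto simp: pair_less_iff)

text \<open>Each insertion condition need only be tested at a few extreme points, such as an end of
  an interval or the first column past it. What remains are inequalities between endpoints.\<close>

lemma interval_gap_iffs:
  fixes a b c d j :: nat
  shows gap_above: "(\<forall>k. c \<le> k \<longrightarrow> k < d \<longrightarrow> (\<forall>z. j < z \<and> z < k \<longrightarrow> c \<le> z \<and> z < d)) \<longleftrightarrow>
      (c < d \<longrightarrow> d \<le> j + 1 \<or> c \<le> j + 1)"
    and gap_below: "(\<forall>k. c \<le> k \<longrightarrow> k < d \<longrightarrow> (\<forall>z. k < z \<and> z < j \<longrightarrow> c \<le> z \<and> z < d)) \<longleftrightarrow>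
      (c < d \<longrightarrow> j \<le> d)"
    and gap_below_cross: "(\<forall>k. a \<le> k \<longrightarrow> k < b \<longrightarrow> (\<forall>z. k < z \<and> z \<le> j \<longrightarrow> a \<le> z \<and> z < b) \<and>
        (\<forall>z. k \<le> z \<and> z < j \<longrightarrow> c \<le> z \<and> z < d)) \<longleftrightarrow>
      (a < b \<longrightarrow> j < b \<and> (j \<le> a \<or> c \<le> a \<and> j \<le> d))"
    and gap_above_cross: "(\<forall>k. c \<le> k \<longrightarrow> k < d \<longrightarrow> (\<forall>z. j < z \<and> z \<le> k \<longrightarrow> a \<le> z \<and> z < b) \<and>
        (\<forall>z. j \<le> z \<and> z < k \<longrightarrow> c \<le> z \<and> z < d)) \<longleftrightarrow>
      (c < d \<longrightarrow> d \<le> j + 1 \<or> c \<le> j \<and> a \<le> j + 1 \<and> d \<le> b)"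
proof -
  show "(\<forall>k. c \<le> k \<longrightarrow> k < d \<longrightarrow> (\<forall>z. j < z \<and> z < k \<longrightarrow> c \<le> z \<and> z < d)) \<longleftrightarrow>
      (c < d \<longrightarrow> d \<le> j + 1 \<or> c \<le> j + 1)" (is "?l \<longleftrightarrow> _")
  proof
    assume ?l
    from this[rule_format, of "d - 1" "j + 1"] show "c < d \<longrightarrow> d \<le> j + 1 \<or> c \<le> j + 1" by linarith
  qed auto
  show "(\<forall>k. c \<le> k \<longrightarrow> k < d \<longrightarrow> (\<forall>z. k < z \<and> z < j \<longrightarrow> c \<le> z \<and> z < d)) \<longleftrightarrow>
      (c < d \<longrightarrow> j \<le> d)" (is "?l \<longleftrightarrow> _")
  proof
    assume ?l
    from this[rule_format, of "d - 1" d] show "c < d \<longrightarrow> j \<le> d" by linarith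
  qed auto
  show "(\<forall>k. a \<le> k \<longrightarrow> k < b \<longrightarrow> (\<forall>z. k < z \<and> z \<le> j \<longrightarrow> a \<le> z \<and> z < b) \<and>
        (\<forall>z. k \<le> z \<and> z < j \<longrightarrow> c \<le> z \<and> z < d)) \<longleftrightarrow>
      (a < b \<longrightarrow> j < b \<and> (j \<le> a \<or> c \<le> a \<and> j \<le> d))" (is "?l \<longleftrightarrow> _")
  proof
    assume l: ?l
    have "a < b \<Longrightarrow> j < b" using l[rule_format, of "b - 1"] by (force dest: conjunct1)
    moreover have "a < b \<Longrightarrow> a < j \<Longrightarrow> c \<le> a" using l[rule_format, of a] by blast
    moreover have "a < b \<Longrightarrow> a < j \<Longrightarrow> j \<le> d" using conjunct2[OF l[rule_format, of a], rule_format, of "j - 1"] by linarith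
    ultimately show "a < b \<longrightarrow> j < b \<and> (j \<le> a \<or> c \<le> a \<and> j \<le> d)" by linarith
  qed auto
  show "(\<forall>k. c \<le> k \<longrightarrow> k < d \<longrightarrow> (\<forall>z. j < z \<and> z \<le> k \<longrightarrow> a \<le> z \<and> z < b) \<and>
        (\<forall>z. j \<le> z \<and> z < k \<longrightarrow> c \<le> z \<and> z < d)) \<longleftrightarrow>
      (c < d \<longrightarrow> d \<le> j + 1 \<or> c \<le> j \<and> a \<le> j + 1 \<and> d \<le> b)" (is "?l \<longleftrightarrow> _")
  proof
    assume l: ?l
    show "c < d \<longrightarrow> d \<le> j + 1 \<or> c \<le> j \<and> a \<le> j + 1 \<and> d \<le> b"
    proof (intro impI)
      assume "c < d"
      then have "c \<le> d - 1" "d - 1 < d" by auto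
      note k = l[rule_format, OF this]
      show "d \<le> j + 1 \<or> c \<le> j \<and> a \<le> j + 1 \<and> d \<le> b"
        using conjunct1[OF k, rule_format, of "j + 1"] conjunct1[OF k, rule_format, of "d - 1"]
          conjunct2[OF k, rule_format, of j] by linarith
    qed
  qed auto
qed

text \<open>The local criterion read column by column: \<open>top\<close> and \<open>bot\<close>
  mention only \<open>j\<close> and the eight endpoints, so a rowmotion step on a concrete shape
  becomes linear arithmetic.\<close>

lemma rowmotion_seg:
  assumes lin: "linear_extension (two_by n) xs" and I: "interval_closed (two_by n) (seg c d a b)"
    and bounds: "c' < d' \<Longrightarrow> 1 \<le> c' \<and> d' \<le> n + 1" "a' < b' \<Longrightarrow> 1 \<le> a' \<and> b' \<le> n + 1"
    and top: "\<And>j. 1 \<le> j \<Longrightarrow> j \<le> n \<Longrightarrow> c' \<le> j \<and> j < d' \<longleftrightarrow>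
      (if c \<le> j \<and> j < d then (c < j \<or> a \<le> j \<and> a < b) \<and> j + 1 < d' \<and> c' < d'
       else (c' < d' \<longrightarrow> d' \<le> j + 1 \<or> c' \<le> j + 1) \<and> (c < d \<longrightarrow> j \<le> d) \<and>
         (a < b \<longrightarrow> j < b \<and> (j \<le> a \<or> c \<le> a \<and> j \<le> d)))"
    and bot: "\<And>j. 1 \<le> j \<Longrightarrow> j \<le> n \<Longrightarrow> a' \<le> j \<and> j < b' \<longleftrightarrow>
      (if a \<le> j \<and> j < b then a < j \<and> (a' < b' \<and> j + 1 < b' \<or> c' < d' \<and> j < d')
       else (a < b \<longrightarrow> j \<le> b) \<and> (a' < b' \<longrightarrow> b' \<le> j + 1 \<or> a' \<le> j + 1) \<and>
         (c' < d' \<longrightarrow> d' \<le> j + 1 \<or> c' \<le> j \<and> a' \<le> j + 1 \<and> d' \<le> b'))"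
  shows "rowmotion (two_by n) xs (seg c d a b) = seg c' d' a' b'"
proof (rule rowmotion_eqI[OF lin I])
  show "seg c' d' a' b' \<subseteq> two_by n" using bounds by (simp add: seg_subset_two_by_iff)
  have "seg c d a b \<subseteq> two_by n" using I unfolding interval_closed_def by blast
  then have I2: "c \<le> k \<Longrightarrow> k < d \<Longrightarrow> 1 \<le> k \<and> k \<le> n" and I1: "a \<le> k \<Longrightarrow> k < b \<Longrightarrow> 1 \<le> k \<and> k \<le> n" for k
    unfolding seg_subset_two_by_iff by auto
  have J2: "1 \<le> k \<and> k \<le> n" if "c' \<le> k" "k < d'" for k using bounds that by auto
  have J1: "1 \<le> k \<and> k \<le> n" if "a' \<le> k" "k < b'" for k using bounds that by auto
  fix x assume "x \<in> two_by n"
  then consider j where "x = (2, j)" "1 \<le> j" "j \<le> n" | j where "x = (1, j)" "1 \<le> j" "j \<le> n"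
    by (auto simp: two_by_def)
  then show "x \<in> seg c' d' a' b' \<longleftrightarrow>
      (if x \<in> seg c d a b then (\<exists>k\<in>seg c d a b. k < x) \<and> (\<exists>k\<in>seg c' d' a' b'. x < k)
       else (\<forall>k\<in>seg c' d' a' b'. \<forall>z\<in>two_by n. x < z \<and> z < k \<longrightarrow> z \<in> seg c' d' a' b') \<and>
         (\<forall>k\<in>seg c d a b. \<forall>z\<in>two_by n. k < z \<and> z < x \<longrightarrow> z \<in> seg c d a b))"
  proof cases
    case 1
    have 2: "(\<exists>k\<in>seg c d a b. k < x) \<longleftrightarrow> c < j \<or> a \<le> j \<and> a < b" if "c \<le> j \<and> j < d"
      unfolding Bex_seg 1 pair_less_iff using that by auto
    have 3: "(\<exists>k\<in>seg c' d' a' b'. x < k) \<longleftrightarrow> j + 1 < d' \<and> c' < d'"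
      unfolding Bex_seg 1 pair_less_iff by (auto intro!: exI[of _ "d' - 1"])
    have "(\<forall>k\<in>seg c' d' a' b'. \<forall>z\<in>two_by n. x < z \<and> z < k \<longrightarrow> z \<in> seg c' d' a' b') \<longleftrightarrow>
        (\<forall>k. c' \<le> k \<longrightarrow> k < d' \<longrightarrow> (\<forall>z. j < z \<and> z < k \<longrightarrow> c' \<le> z \<and> z < d'))"
      unfolding Ball_seg 1 using J1 J2 1 by (simp add: between_two_by not_between_top_bottom del: One_nat_def cong: imp_cong)
    note 4 = this[unfolded gap_above]
    have "(\<forall>k\<in>seg c d a b. \<forall>z\<in>two_by n. k < z \<and> z < x \<longrightarrow> z \<in> seg c d a b) \<longleftrightarrow>
        (\<forall>k. c \<le> k \<longrightarrow> k < d \<longrightarrow> (\<forall>z. k < z \<and> z < j \<longrightarrow> c \<le> z \<and> z < d)) \<and>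
        (\<forall>k. a \<le> k \<longrightarrow> k < b \<longrightarrow> (\<forall>z. k < z \<and> z \<le> j \<longrightarrow> a \<le> z \<and> z < b) \<and>
          (\<forall>z. k \<le> z \<and> z < j \<longrightarrow> c \<le> z \<and> z < d))"
      unfolding Ball_seg 1 using I1 I2 1 by (simp add: between_two_by not_between_top_bottom del: One_nat_def cong: imp_cong)
    note 5 = this[unfolded gap_below gap_below_cross]
    show ?thesis unfolding 3 4 5 using top[OF 1(2,3)] 2 by (simp add: 1)
  next
    case 2
    have 3: "(\<exists>k\<in>seg c d a b. k < x) \<longleftrightarrow> a < j" if "a \<le> j \<and> j < b"
      unfolding Bex_seg 2 pair_less_iff using that by auto
    have 4: "(\<exists>k\<in>seg c' d' a' b'. x < k) \<longleftrightarrow> a' < b' \<and> j + 1 < b' \<or> c' < d' \<and> j < d'"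
    proof -
      have "(\<exists>k. c' \<le> k \<and> k < d' \<and> j \<le> k) \<longleftrightarrow> c' < d' \<and> j < d'"
        by (auto intro!: exI[of _ "d' - 1"])
      moreover have "(\<exists>k. a' \<le> k \<and> k < b' \<and> j < k) \<longleftrightarrow> a' < b' \<and> j + 1 < b'"
        by (auto intro!: exI[of _ "b' - 1"])
      ultimately show ?thesis unfolding Bex_seg 2 pair_less_iff by auto
    qed
    have "(\<forall>k\<in>seg c d a b. \<forall>z\<in>two_by n. k < z \<and> z < x \<longrightarrow> z \<in> seg c d a b) \<longleftrightarrow>
        (\<forall>k. a \<le> k \<longrightarrow> k < b \<longrightarrow> (\<forall>z. k < z \<and> z < j \<longrightarrow> a \<le> z \<and> z < b))"
      unfolding Ball_seg 2 using I1 I2 2 by (simp add: between_two_by not_between_top_bottom del: One_nat_def cong: imp_cong)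
    note 5 = this[unfolded gap_below]
    have "(\<forall>k\<in>seg c' d' a' b'. \<forall>z\<in>two_by n. x < z \<and> z < k \<longrightarrow> z \<in> seg c' d' a' b') \<longleftrightarrow>
        (\<forall>k. c' \<le> k \<longrightarrow> k < d' \<longrightarrow> (\<forall>z. j < z \<and> z \<le> k \<longrightarrow> a' \<le> z \<and> z < b') \<and>
          (\<forall>z. j \<le> z \<and> z < k \<longrightarrow> c' \<le> z \<and> z < d')) \<and>
        (\<forall>k. a' \<le> k \<longrightarrow> k < b' \<longrightarrow> (\<forall>z. j < z \<and> z < k \<longrightarrow> a' \<le> z \<and> z < b'))"
      unfolding Ball_seg 2 using J1 J2 2 by (simp add: between_two_by not_between_top_bottom del: One_nat_def cong: imp_cong)
    note 6 = this[unfolded gap_above gap_above_cross]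
    show ?thesis unfolding 4 5 6 using bot[OF 2(2,3)] 3 by (auto simp: 2)
  qed
qed

section \<open>Rowmotion on pairs of intervals\<close>

text \<open>If \<open>d \<le> a\<close>, no bottom element lies below a top one. Otherwise the other
  alternative supplies everything between a bottom and a top element.\<close>

lemma interval_closed_seg:
  assumes "c < d \<Longrightarrow> 1 \<le> c \<and> d \<le> n + 1" "a < b \<Longrightarrow> 1 \<le> a \<and> b \<le> n + 1"
    and "c < d \<Longrightarrow> a < b \<Longrightarrow> d \<le> a \<or> c \<le> a \<and> d \<le> b"
  shows "interval_closed (two_by n) (seg c d a b)"
proof -
  have "seg c d a b \<subseteq> two_by n" using assms(1,2) by (simp add: seg_subset_two_by_iff)
  then show ?thesis unfolding interval_closed_def Ball_seg Ball_two_by using assms(3) by auto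
qed

locale two_by_rowmotion =
  fixes n :: nat and xs
  assumes lin: "linear_extension (two_by n) xs"
begin

abbreviation row :: "(nat \<times> nat) set \<Rightarrow> (nat \<times> nat) set" where
  "row \<equiv> rowmotion (two_by n) xs"

lemmas row_seg = rowmotion_seg[OF lin interval_closed_seg]

text \<open>In the names, \<open>T\<close>, \<open>B\<close> and \<open>X\<close> stand for maximal runs of columns that meet the set in the top element
  only, the bottom element only, or both, read from left to right; \<open>gap\<close> is a \<open>T\<close>-run and a \<open>B\<close>-run
  separated by at least one empty column.\<close>

lemma row_B:
  assumes "1 \<le> a" "a < b" "b \<le> n"
  shows "row (seg 0 0 a b) = seg 1 (a + 1) (a + 1) (b + 1)"
  by (rule row_seg) (use assms in auto)

lemma row_B_end:
  assumes "1 \<le> a" "a \<le> n"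
  shows "row (seg 0 0 a (n + 1)) = seg 1 (a + 1) 0 0"
  by (rule row_seg) (use assms in auto)

text \<open>Away from the right wall all endpoints move right by one; \<open>row_B\<close> is the
  same rule with the empty top row read as \<open>c = 0\<close>.\<close>

lemma row_TB:
  assumes "1 \<le> c" "c < a" "a < b" "b \<le> n"
  shows "row (seg c a a b) = seg (c + 1) (a + 1) (a + 1) (b + 1)"
  by (rule row_seg) (use assms in auto)

lemma row_TB_end:
  assumes "1 \<le> c" "c < a" "a \<le> n"
  shows "row (seg c a a (n + 1)) = seg (c + 1) (a + 1) 0 0"
  by (rule row_seg) (use assms in auto)

lemma row_T:
  assumes "1 \<le> c" "c < d" "d \<le> n"
  shows "row (seg c d 0 0) = seg (c + 1) (d + 1) (c + 1) (n + 1)"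
  by (rule row_seg) (use assms in auto)

lemma row_T_end:
  assumes "1 < c" "c \<le> n"
  shows "row (seg c (n + 1) 0 0) = seg 1 c 1 (n + 1)"
  by (rule row_seg) (use assms in auto)

lemma row_T_full:
  assumes "1 \<le> n"
  shows "row (seg 1 (n + 1) 0 0) = seg 0 0 1 (n + 1)"
  by (rule row_seg) (use assms in auto)

lemma row_XB:
  assumes "1 \<le> c" "c < d" "d \<le> n"
  shows "row (seg c d c (n + 1)) = seg 1 (d + 1) (c + 1) (d + 1)"
  by (rule row_seg) (use assms in auto)

lemma row_XB_end:
  assumes "1 < c" "c \<le> n"
  shows "row (seg c (n + 1) c (n + 1)) = seg 1 c 1 c"
  by (rule row_seg) (use assms in auto)

lemma row_TX:
  assumes "1 \<le> a" "a < d" "d \<le> n"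
  shows "row (seg 1 d a d) = seg 0 0 (a + 1) (d + 1)"
  by (rule row_seg) (use assms in auto)

lemma row_TX_end:
  assumes "1 < a" "a \<le> n"
  shows "row (seg 1 (n + 1) a (n + 1)) = seg 0 0 1 a"
  by (rule row_seg) (use assms in auto)

lemma row_empty: "row (seg 0 0 0 0) = seg 1 (n + 1) 1 (n + 1)"
  by (rule row_seg) auto

lemma row_all: "row (seg 1 (n + 1) 1 (n + 1)) = seg 0 0 0 0"
  by (rule row_seg) auto

lemma row_TXB:
  assumes "1 \<le> c" "c < a" "a < d" "d < b" "b \<le> n"
  shows "row (seg c d a b) = seg (c + 1) (d + 1) (a + 1) (b + 1)"
  by (rule row_seg) (use assms in auto)

lemma row_TXB_end:
  assumes "1 \<le> c" "c < a" "a < d" "d \<le> n"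
  shows "row (seg c d a (n + 1)) = seg (c + 1) (d + 1) (a + 1) (d + 1)"
  by (rule row_seg) (use assms in auto)

text \<open>Unlike for \<open>c < a\<close>, the leftmost top element has \<open>(1, a)\<close>
  below it and is kept; the top row then fills up to the left wall.\<close>

lemma row_TXB_left:
  assumes "1 \<le> a" "a < d" "d < b" "b \<le> n"
  shows "row (seg a d a b) = seg 1 (d + 1) (a + 1) (b + 1)"
  by (rule row_seg) (use assms in auto)

lemma row_TXB_right:
  assumes "1 < c" "c \<le> a" "a < b" "b \<le> n"
  shows "row (seg c b a b) = seg 1 c (a + 1) (b + 1)"
  by (rule row_seg) (use assms in auto)

lemma row_TXB_right_end:
  assumes "1 < c" "c < a" "a \<le> n"
  shows "row (seg c (n + 1) a (n + 1)) = seg 1 c 1 a"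
  by (rule row_seg) (use assms in auto)

lemma row_gap:
  assumes "1 \<le> c" "c < d" "d < a" "a < b" "b \<le> n"
  shows "row (seg c d a b) = seg (c + 1) (d + 1) (a + 1) (b + 1)"
  by (rule row_seg) (use assms in auto)

text \<open>Nothing in the new set lies above an old bottom element, so the bottom run disappears
  and the columns from \<open>c + 1\<close> to \<open>a - 1\<close> are filled instead.\<close>

lemma row_gap_end:
  assumes "1 \<le> c" "c < d" "d < a" "a \<le> n"
  shows "row (seg c d a (n + 1)) = seg (c + 1) (d + 1) (c + 1) a"
  by (rule row_seg) (use assms in auto)

end

section \<open>Sums over orbits\<close>

lemma interval_closed_toggle: "interval_closed P I \<Longrightarrow> interval_closed P (toggle P x I)"
  by (simp add: toggle_def)

lemma toggle_toggle:
  assumes "interval_closed P I"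
  shows "toggle P x (toggle P x I) = I"
proof -
  have "sym_diff (sym_diff I {x}) {x} = I" by auto
  then show ?thesis using assms by (simp add: toggle_def)
qed

lemma interval_closed_rowmotion:
  "interval_closed P I \<Longrightarrow> interval_closed P (rowmotion P xs I)"
  unfolding rowmotion_def by (induction xs) (auto intro: interval_closed_toggle)

text \<open>Rowmotion is a composition of toggles, each an involution on interval-closed
  sets.\<close>

lemma inj_on_rowmotion: "inj_on (rowmotion P xs) {I. interval_closed P I}"
proof (induction xs)
  case Nil
  then show ?case by (simp add: rowmotion_def)
next
  case (Cons x xs)
  have eq: "rowmotion P (x # xs) I = toggle P x (rowmotion P xs I)" for I
    by (simp add: rowmotion_def)
  show ?case
  proof (rule inj_onI)
    fix I J assume "I \<in> {I. interval_closed P I}" "J \<in> {I. interval_closed P I}"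
      and "rowmotion P (x # xs) I = rowmotion P (x # xs) J"
    then show "I = J"
      using Cons.IH toggle_toggle interval_closed_rowmotion unfolding eq inj_on_def
      by (metis mem_Collect_eq)
  qed
qed

lemma funpow_closed:
  assumes "f ` A \<subseteq> A" "x \<in> A"
  shows "(f ^^ k) x \<in> A"
  using assms by (induction k) auto

text \<open>\<open>orbit\<close> uses positive exponents only, so periodicity is required: two
  iterates coincide by finiteness, and injectivity cancels the common part.\<close>

lemma self_in_orbit_if_inj_on:
  assumes "finite A" "f ` A \<subseteq> A" "inj_on f A" "x \<in> A"
  shows "x \<in> orbit f x"
proof -
  have inA: "(f ^^ k) y \<in> A" if "y \<in> A" for k y using funpow_closed[OF assms(2) that] .
  have "range (\<lambda>k. (f ^^ k) x) \<subseteq> A" using inA[OF assms(4)] by auto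
  then have "\<not> inj (\<lambda>k. (f ^^ k) x)"
    using assms(1) finite_subset finite_imageD infinite_UNIV_nat by metis
  then obtain i j where ij: "i < j" "(f ^^ i) x = (f ^^ j) x"
    unfolding inj_on_def by (metis linorder_neqE_nat)
  have inj: "inj_on (f ^^ i) A"
  proof (induction i)
    case (Suc i)
    then show ?case using assms(3) inA unfolding inj_on_def by simp
  qed simp
  have "(f ^^ i) ((f ^^ (j - i)) x) = (f ^^ i) x"
    using ij by (metis comp_apply funpow_add le_add_diff_inverse less_imp_le)
  then have "(f ^^ (j - i)) x = x"
    using inj inA assms(4) unfolding inj_on_def by blast
  then show ?thesis using ij(1) unfolding orbit_altdef by (auto intro!: exI[of _ "j - i"])
qed

text \<open>The orbit is a cycle of length \<open>funpow_dist1 f x x\<close>, the least positive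
  period, and the increments of \<open>F\<close> once around a cycle cancel.\<close>

lemma sum_orbit_telescope:
  fixes F :: "'a \<Rightarrow> int"
  assumes "x \<in> orbit f x" "\<And>y. y \<in> orbit f x \<Longrightarrow> F (f y) - F y = g y"
  shows "(\<Sum>y\<in>orbit f x. g y) = 0"
proof -
  define p where "p = funpow_dist1 f x x"
  have orb: "orbit f x = (\<lambda>k. (f ^^ k) x) ` {0..<p}"
    unfolding p_def by (rule orbit_conv_funpow_dist1[OF assms(1)])
  have inj: "inj_on (\<lambda>k. (f ^^ k) x) {0..<p}"
    unfolding p_def by (rule inj_on_funpow_dist1[OF assms(1)])
  have per: "(f ^^ p) x = x" unfolding p_def by (rule funpow_dist1_prop[OF assms(1)])
  have "(\<Sum>y\<in>orbit f x. g y) = (\<Sum>k<p. g ((f ^^ k) x))"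
    unfolding orb sum.reindex[OF inj] by (simp add: lessThan_atLeast0)
  also have "\<dots> = (\<Sum>k<p. F ((f ^^ Suc k) x) - F ((f ^^ k) x))"
    using assms(2) orb by (intro sum.cong) auto
  also have "\<dots> = F ((f ^^ p) x) - F x" by (subst sum_lessThan_telescope) simp
  finally show ?thesis using per by simp
qed

lemma funpow_card_orbit:
  assumes "x \<in> orbit f x"
  shows "(f ^^ card (orbit f x)) x = x"
proof -
  have "card (orbit f x) = funpow_dist1 f x x"
    unfolding orbit_conv_funpow_dist1[OF assms]
    using card_image[OF inj_on_funpow_dist1[OF assms]] by simp
  then show ?thesis using funpow_dist1_prop[OF assms] by simp
qed

section \<open>Signed cardinality in terms of endpoint parities\<close>

lemma two_sum_minus_one_power:
  assumes "a \<le> b"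
  shows "2 * (\<Sum>j=a..<b. (-1) ^ j) = ((-1) ^ a - (-1) ^ b :: int)"
  using assms by (induction b rule: dec_induct) auto

lemma sum_singleton_times: "(\<Sum>x\<in>{i} \<times> A. g x) = (\<Sum>j\<in>A. g (i, j))"
proof -
  have "{i} \<times> A = Pair i ` A" by auto
  then show ?thesis by (simp add: sum.reindex inj_on_def)
qed

text \<open>Both row sums alternate and telescope. The ranks in column \<open>j\<close> are
  \<open>j\<close> on top and \<open>j - 1\<close> below, so the rows carry opposite signs; doubling
  avoids fractions.\<close>

lemma signed_card_seg:
  assumes "c \<le> d" "a \<le> b" "a = 0 \<Longrightarrow> b = 0"
  shows "2 * signed_card (seg c d a b) = (-1) ^ c - (-1) ^ d - (-1) ^ a + (-1) ^ b"
proof -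
  have "signed_card (seg c d a b) =
      (\<Sum>x\<in>{2} \<times> {c..<d}. (-1) ^ grid_rank x) + (\<Sum>x\<in>{1} \<times> {a..<b}. (-1) ^ grid_rank x)"
    unfolding signed_card_def seg_def by (rule sum.union_disjoint) auto
  moreover have "(\<Sum>x\<in>{2} \<times> {c..<d}. (-1) ^ grid_rank x) = (\<Sum>j=c..<d. (-1) ^ j :: int)"
    by (simp add: sum_singleton_times grid_rank_def)
  moreover have "(\<Sum>x\<in>{1} \<times> {a..<b}. (-1) ^ grid_rank x) = (\<Sum>j=a..<b. - ((-1) ^ j) :: int)"
  proof -
    \<comment> \<open>The subtraction would be truncated at \<open>j = 0\<close>; the third
      assumption keeps column 0 out of the bottom row.\<close>
    have "(-1) ^ (j - 1) = (- ((-1) ^ j) :: int)" if "j \<in> {a..<b}" for j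
      using that assms(3) by (cases j) auto
    then show ?thesis by (simp add: sum_singleton_times grid_rank_def)
  qed
  ultimately show ?thesis
    using two_sum_minus_one_power[OF assms(1)] two_sum_minus_one_power[OF assms(2)]
    by (simp add: sum_negf)
qed

section \<open>Parity potentials\<close>

text \<open>Potentials are functions of sets, so the endpoints are recovered from the set. The
  values on an empty row are unspecified and must not be used.\<close>

definition row_min :: "nat \<Rightarrow> (nat \<times> nat) set \<Rightarrow> nat" where
  "row_min i S = Min {j. (i, j) \<in> S}"

definition row_end :: "nat \<Rightarrow> (nat \<times> nat) set \<Rightarrow> nat" where
  "row_end i S = Suc (Max {j. (i, j) \<in> S})"

lemma row_ends_seg [simp]:
  "c < d \<Longrightarrow> row_min 2 (seg c d a b) = c" "c < d \<Longrightarrow> row_end 2 (seg c d a b) = d"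
  "a < b \<Longrightarrow> row_min 1 (seg c d a b) = a" "a < b \<Longrightarrow> row_end 1 (seg c d a b) = b"
proof -
  have *: "Min {x..<y} = x" "Suc (Max {x..<y}) = y" if "x < y" for x y :: nat
  proof -
    show "Min {x..<y} = x" using that by (intro Min_eqI) auto
    have "Max {x..<y} = y - 1" using that by (intro Max_eqI) auto
    then show "Suc (Max {x..<y}) = y" using that by simp
  qed
  have rows: "{j. (2, j) \<in> seg c d a b} = {c..<d}" "{j. (1, j) \<in> seg c d a b} = {a..<b}"
    by auto
  show "c < d \<Longrightarrow> row_min 2 (seg c d a b) = c" "c < d \<Longrightarrow> row_end 2 (seg c d a b) = d"
    "a < b \<Longrightarrow> row_min 1 (seg c d a b) = a" "a < b \<Longrightarrow> row_end 1 (seg c d a b) = b"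
    unfolding row_min_def row_end_def rows by (simp_all add: *)
qed

lemma row_ends_seg_Suc_0 [simp]:
  "a < b \<Longrightarrow> row_min (Suc 0) (seg c d a b) = a" "a < b \<Longrightarrow> row_end (Suc 0) (seg c d a b) = b"
  using row_ends_seg(3,4) by simp_all

definition empty_row :: "nat \<Rightarrow> (nat \<times> nat) set \<Rightarrow> bool" where
  "empty_row i S \<longleftrightarrow> (\<forall>j. (i, j) \<notin> S)"

lemma empty_row_seg [simp]:
  "empty_row 2 (seg c d a b) \<longleftrightarrow> d \<le> c" "empty_row (Suc 0) (seg c d a b) \<longleftrightarrow> b \<le> a"
  unfolding empty_row_def by (auto simp: not_less[symmetric])

text \<open>One of the two rowmotion-invariant families of nontrivial interval-closed sets; the other one
  consists of the types \<open>T\<close>, \<open>B\<close>, \<open>TB\<close> without gap, \<open>TX\<close> starting at the left wall and \<open>XB\<close> ending at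
  the right wall.\<close>

definition loose :: "nat \<Rightarrow> (nat \<times> nat) set \<Rightarrow> bool" where
  "loose n S \<longleftrightarrow> (\<exists>c d a b. S = seg c d a b \<and> 1 \<le> c \<and> c < d \<and> a < b \<and> b \<le> n + 1 \<and>
    (d < a \<or> c \<le> a \<and> a < d \<and> d \<le> b \<and> \<not> (c = 1 \<and> d = b) \<and> \<not> (c = a \<and> b = n + 1)))"

lemma looseI:
  assumes "1 \<le> c" "c < d" "a < b" "b \<le> n + 1"
    and "d < a \<or> c \<le> a \<and> a < d \<and> d \<le> b \<and> \<not> (c = 1 \<and> d = b) \<and> \<not> (c = a \<and> b = n + 1)"
  shows "loose n (seg c d a b)"
  using assms unfolding loose_def by blast

text \<open>A shift of all endpoints by one negates \<open>signed_card\<close>, which fixes the linear part as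
  \<open>- 2 * signed_card\<close>; the products of two signs correct for the steps that hit a wall.\<close>

definition loose_potential :: "(nat \<times> nat) set \<Rightarrow> int" where
  "loose_potential S = (let c = row_min 2 S; d = row_end 2 S; a = row_min 1 S; b = row_end 1 S in
    - ((-1) ^ c) + (-1) ^ d + (-1) ^ a - (-1) ^ b +
    (if d < a then - ((-1) ^ (c + b)) - (-1) ^ (d + a) else (-1) ^ (c + a) + (-1) ^ (d + b)))"

context two_by_rowmotion
begin

text \<open>The cases record which walls or column coincidences affect the step. In each, the new
  endpoints are old ones up to a shift or a constant, and the increment becomes an identity between
  signs.\<close>

lemma loose_step:
  assumes "odd n" "loose n S"
  shows "loose n (row S) \<and> loose_potential (row S) - loose_potential S = 4 * signed_card S"
proof -
  obtain c d a b where S: "S = seg c d a b" and r: "1 \<le> c" "c < d" "a < b" "b \<le> n + 1" and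
    t: "d < a \<or> c \<le> a \<and> a < d \<and> d \<le> b \<and> \<not> (c = 1 \<and> d = b) \<and> \<not> (c = a \<and> b = n + 1)"
    using assms(2) unfolding loose_def by blast
  have sc: "4 * signed_card S = 2 * ((-1) ^ c - (-1) ^ d - (-1) ^ a + (-1) ^ b)"
    using signed_card_seg[of c d a b] r t unfolding S by auto
  \<comment> \<open>Oddness of \<open>n\<close> enters here: an endpoint \<open>n + 1\<close> at the
    right wall has sign +1.\<close>
  have n: "(-1) ^ n = (-1 :: int)" using \<open>odd n\<close> by simp
  consider (shift) "d < a" "b \<le> n" | (wrap) "d < a" "b = n + 1"
    | (x) "c < a" "a < d" "d < b" "b \<le> n" | (x_end) "c < a" "a < d" "d < b" "b = n + 1"
    | (left) "c = a" "a < d" "d < b" "b \<le> n" | (right) "c > 1" "c \<le> a" "a < d" "d = b" "b \<le> n"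
    | (right_end) "c > 1" "c < a" "a < d" "d = b" "b = n + 1"
    using t r by (cases "b \<le> n"; cases "d < a"; cases "c = a"; cases "d = b") auto
  then show ?thesis
  proof cases
    case shift
    have "row S = seg (c + 1) (d + 1) (a + 1) (b + 1)" unfolding S using shift r by (intro row_gap) auto
    moreover have "loose n (seg (c + 1) (d + 1) (a + 1) (b + 1))"
      using shift r by (intro looseI) auto
    ultimately show ?thesis unfolding sc unfolding S using shift r
      by (simp add: loose_potential_def power_add)
  next
    case wrap
    have "row S = seg (c + 1) (d + 1) (c + 1) a" unfolding S wrap(2) using wrap r by (intro row_gap_end) auto
    moreover have "loose n (seg (c + 1) (d + 1) (c + 1) a)"
      using wrap r by (intro looseI) auto
    ultimately show ?thesis unfolding sc unfolding S using wrap r n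
      by (simp add: loose_potential_def power_add)
  next
    case x
    have "row S = seg (c + 1) (d + 1) (a + 1) (b + 1)" unfolding S using x r by (intro row_TXB) auto
    moreover have "loose n (seg (c + 1) (d + 1) (a + 1) (b + 1))"
      using x r by (intro looseI) auto
    ultimately show ?thesis unfolding sc unfolding S using x r
      by (simp add: loose_potential_def power_add)
  next
    case x_end
    have "row S = seg (c + 1) (d + 1) (a + 1) (d + 1)" unfolding S x_end(4) using x_end r by (intro row_TXB_end) auto
    moreover have "loose n (seg (c + 1) (d + 1) (a + 1) (d + 1))"
      using x_end r by (intro looseI) auto
    ultimately show ?thesis unfolding sc unfolding S using x_end r n
      by (simp add: loose_potential_def power_add)
  next
    case left
    have "row S = seg 1 (d + 1) (a + 1) (b + 1)" unfolding S left(1) using left r by (intro row_TXB_left) auto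
    moreover have "loose n (seg 1 (d + 1) (a + 1) (b + 1))"
      using left r by (intro looseI) auto
    ultimately show ?thesis unfolding sc unfolding S using left r n
      by (simp add: loose_potential_def power_add)
  next
    case right
    have "row S = seg 1 c (a + 1) (b + 1)" unfolding S right(4) using right r by (intro row_TXB_right) auto
    moreover have "loose n (seg 1 c (a + 1) (b + 1))"
      using right r by (intro looseI) auto
    ultimately show ?thesis unfolding sc unfolding S using right r n
      by (simp add: loose_potential_def power_add)
  next
    case right_end
    have "row S = seg 1 c 1 a" unfolding S right_end(4,5) using right_end r by (intro row_TXB_right_end) auto
    moreover have "loose n (seg 1 c 1 a)"
      using right_end r by (intro looseI) auto
    ultimately show ?thesis unfolding sc unfolding S using right_end r n
      by (simp add: loose_potential_def power_add)
  qed
qed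

end

text \<open>The branches belong to the types \<open>B\<close>, \<open>T\<close>, \<open>TB\<close>,
  \<open>XB\<close> and \<open>TX\<close>, in this order. Empty rows are tested first because their
  endpoints are unspecified.\<close>

definition tight_potential :: "nat \<Rightarrow> (nat \<times> nat) set \<Rightarrow> int" where
  "tight_potential n S = (let c = row_min 2 S; d = row_end 2 S; a = row_min 1 S; b = row_end 1 S in
    if empty_row 2 S then 2 - 2 * (-1) ^ b
    else if empty_row 1 S then 2 + 2 * (-1) ^ d
    else if d = a then 1 - (-1) ^ c + 2 * (-1) ^ a - (-1) ^ b - (-1) ^ (c + b)
    else if b = n + 1 then 2 - 2 * (-1) ^ c
    else 4 + 2 * (-1) ^ d + 2 * (-1) ^ a)"

text \<open>The states passed through from a \<open>B\<close>-state of length at least 4 up to the next \<open>B\<close>-state: the top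
  row never touches the right wall in between.\<close>

inductive generic :: "nat \<Rightarrow> (nat \<times> nat) set \<Rightarrow> bool" for n where
  B: "1 \<le> a \<Longrightarrow> a + 4 \<le> b \<Longrightarrow> b \<le> n + 1 \<Longrightarrow> generic n (seg 0 0 a b)"
| TB: "1 \<le> c \<Longrightarrow> c < a \<Longrightarrow> a + 4 \<le> b \<Longrightarrow> b \<le> n + 1 \<Longrightarrow> generic n (seg c a a b)"
| T: "1 \<le> c \<Longrightarrow> c < d \<Longrightarrow> d + 2 \<le> n \<Longrightarrow> generic n (seg c d 0 0)"
| XB: "1 \<le> c \<Longrightarrow> c < d \<Longrightarrow> d + 1 \<le> n \<Longrightarrow> generic n (seg c d c (n + 1))"
| TX: "1 \<le> a \<Longrightarrow> a < d \<Longrightarrow> d \<le> n \<Longrightarrow> generic n (seg 1 d a d)"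

context two_by_rowmotion
begin

text \<open>Length at least 4 at a \<open>B\<close>-state leaves enough room at the right wall until
  the next \<open>B\<close>-state. Only the step from \<open>TX\<close> to \<open>B\<close> could
  leave the family, and the third assumption bounds the length there.\<close>

lemma generic_step:
  assumes "odd n" "generic n S"
    and "\<And>a b. row S = seg 0 0 a b \<Longrightarrow> a < b \<Longrightarrow> a + 4 \<le> b"
  shows "generic n (row S) \<and> tight_potential n (row S) - tight_potential n S = 4 * signed_card S"
proof -
  have n: "(-1) ^ n = (-1 :: int)" using \<open>odd n\<close> by simp
  have sc: "4 * signed_card (seg c d a b) = 2 * ((-1) ^ c - (-1) ^ d - (-1) ^ a + (-1) ^ b)"
    if "c \<le> d" "a \<le> b" "a = 0 \<Longrightarrow> b = 0" for c d a b
    using signed_card_seg[OF that] by simp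
  from assms(2) show ?thesis
  proof cases
    case (B a b)
    show ?thesis
    proof (cases "b = n + 1")
      case True
      have "row S = seg 1 (a + 1) 0 0" unfolding B(1) True using B True by (intro row_B_end) auto
      moreover have "generic n (seg 1 (a + 1) 0 0)" using B True by (intro generic.T) auto
      ultimately show ?thesis unfolding B(1) using sc[of 0 0 a b] B n True
        by (simp add: tight_potential_def power_add)
    next
      case False
      have "row S = seg 1 (a + 1) (a + 1) (b + 1)" unfolding B(1) using B False by (intro row_B) auto
      moreover have "generic n (seg 1 (a + 1) (a + 1) (b + 1))" using B False by (intro generic.TB) auto
      ultimately show ?thesis unfolding B(1) using sc[of 0 0 a b] B n False
        by (simp add: tight_potential_def power_add)
    qed
  next
    case (TB c a b)
    show ?thesis
    proof (cases "b = n + 1")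
      case True
      have "row S = seg (c + 1) (a + 1) 0 0" unfolding TB(1) True using TB True by (intro row_TB_end) auto
      moreover have "generic n (seg (c + 1) (a + 1) 0 0)" using TB True by (intro generic.T) auto
      ultimately show ?thesis unfolding TB(1) using sc[of c a a b] TB n True
        by (simp add: tight_potential_def power_add)
    next
      case False
      have "row S = seg (c + 1) (a + 1) (a + 1) (b + 1)" unfolding TB(1) using TB False by (intro row_TB) auto
      moreover have "generic n (seg (c + 1) (a + 1) (a + 1) (b + 1))" using TB False by (intro generic.TB) auto
      ultimately show ?thesis unfolding TB(1) using sc[of c a a b] TB n False
        by (simp add: tight_potential_def power_add)
    qed
  next
    case (T c d)
    have "row S = seg (c + 1) (d + 1) (c + 1) (n + 1)" unfolding T(1) using T by (intro row_T) auto
    moreover have "generic n (seg (c + 1) (d + 1) (c + 1) (n + 1))" using T by (intro generic.XB) auto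
    ultimately show ?thesis unfolding T(1) using sc[of c d 0 0] T n
      by (simp add: tight_potential_def power_add)
  next
    case (XB c d)
    have "row S = seg 1 (d + 1) (c + 1) (d + 1)" unfolding XB(1) using XB by (intro row_XB) auto
    moreover have "generic n (seg 1 (d + 1) (c + 1) (d + 1))" using XB by (intro generic.TX) auto
    ultimately show ?thesis unfolding XB(1) using sc[of c d c "n + 1"] XB n
      by (simp add: tight_potential_def power_add)
  next
    case (TX a d)
    have row: "row S = seg 0 0 (a + 1) (d + 1)" unfolding TX(1) using TX by (intro row_TX) auto
    moreover have "generic n (seg 0 0 (a + 1) (d + 1))" using TX assms(3)[OF row] by (intro generic.B) auto
    ultimately show ?thesis unfolding TX(1) using sc[of 1 d a d] TX n
      by (simp add: tight_potential_def power_add)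
  qed
qed

end

section \<open>Visits to the bottom row\<close>

lemma funpow_trans: "(f ^^ k) x = y \<Longrightarrow> (f ^^ m) y = z \<Longrightarrow> k + m = l \<Longrightarrow> (f ^^ l) x = z"
  by (metis add.commute comp_apply funpow_add)

lemma funpow_2: "(f ^^ 2) x = f (f x)" and funpow_3: "(f ^^ 3) x = f (f (f x))"
  by (simp_all add: numeral_eq_Suc)

context two_by_rowmotion
begin

lemma funpow_row_B:
  assumes "1 \<le> x" "x < y" "y + k \<le> n"
  shows "(row ^^ Suc k) (seg 0 0 x y) = seg (k + 1) (x + k + 1) (x + k + 1) (y + k + 1)"
  using assms(3)
proof (induction k)
  case 0
  then show ?case using row_B[of x y] assms by simp
next
  case (Suc k)
  then have "(row ^^ Suc (Suc k)) (seg 0 0 x y) = row (seg (k + 1) (x + k + 1) (x + k + 1) (y + k + 1))"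
    by simp
  also have "\<dots> = seg (Suc k + 1) (x + Suc k + 1) (x + Suc k + 1) (y + Suc k + 1)"
    using row_TB[of "k + 1" "x + k + 1" "y + k + 1"] Suc.prems assms by simp
  finally show ?case .
qed

text \<open>The bottom interval reaches the right wall after \<open>n + 1 - y\<close> shifts, and
  one further step empties the bottom row.\<close>

lemma B_to_T:
  assumes "1 \<le> x" "x < y" "y \<le> n + 1" "y + k = n + 2"
  shows "(row ^^ k) (seg 0 0 x y) = seg k (x + k) 0 0"
proof (cases "y = n + 1")
  case True
  then show ?thesis using row_B_end[of x] assms by simp
next
  case False
  define m where "m = k - 2"
  have m: "k = Suc (Suc m)" "y + m = n" using assms False unfolding m_def by auto
  have "(row ^^ k) (seg 0 0 x y) = row ((row ^^ Suc m) (seg 0 0 x y))" unfolding m by simp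
  also have "\<dots> = row (seg (m + 1) (x + m + 1) (x + m + 1) (n + 1))"
    using funpow_row_B[of x y m] assms m by simp
  also have "\<dots> = seg k (x + k) 0 0"
    using row_TB_end[of "m + 1" "x + m + 1"] assms m by simp
  finally show ?thesis .
qed

text \<open>By \<open>B_to_T\<close> a \<open>B\<close>-state of length 1, 2 or 3 leads to a
  \<open>T\<close>-state with right end \<open>n + 1\<close>, \<open>n\<close> or
  \<open>n - 1\<close>. These are the returns in which the top row meets the right wall.\<close>

lemma T_to_B:
  assumes "1 \<le> c"
  shows "1 < c \<Longrightarrow> c < n \<Longrightarrow> (row ^^ 3) (seg c (n + 1) 0 0) = seg 0 0 3 (c + 2)"
    and "c < n \<Longrightarrow> (row ^^ 3) (seg c n 0 0) = seg 0 0 2 (c + 2)"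
    and "c + 1 < n \<Longrightarrow> (row ^^ 3) (seg c (n - 1) 0 0) = seg 0 0 1 (c + 2)"
proof -
  show "(row ^^ 3) (seg c (n + 1) 0 0) = seg 0 0 3 (c + 2)" if "1 < c" "c < n"
  proof -
    have "row (seg c (n + 1) 0 0) = seg 1 c 1 (n + 1)" by (rule row_T_end) (use that in auto)
    moreover have "row \<dots> = seg 1 (c + 1) 2 (c + 1)" using row_XB[of 1 c] that by (simp add: numeral_eq_Suc)
    moreover have "row \<dots> = seg 0 0 3 (c + 2)" using row_TX[of 2 "c + 1"] that by (simp add: numeral_eq_Suc)
    ultimately show ?thesis by (simp only: funpow_3)
  qed
  show "(row ^^ 3) (seg c n 0 0) = seg 0 0 2 (c + 2)" if "c < n"
  proof -
    have "row (seg c n 0 0) = seg (c + 1) (n + 1) (c + 1) (n + 1)" by (rule row_T) (use that assms in auto)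
    moreover have "row \<dots> = seg 1 (c + 1) 1 (c + 1)" by (rule row_XB_end) (use that assms in auto)
    moreover have "row \<dots> = seg 0 0 2 (c + 2)" using row_TX[of 1 "c + 1"] that assms by (simp add: numeral_eq_Suc)
    ultimately show ?thesis by (simp only: funpow_3)
  qed
  show "(row ^^ 3) (seg c (n - 1) 0 0) = seg 0 0 1 (c + 2)" if "c + 1 < n"
  proof -
    have "row (seg c (n - 1) 0 0) = seg (c + 1) n (c + 1) (n + 1)"
      using row_T[of c "n - 1"] that assms by (simp add: numeral_eq_Suc)
    moreover have "row \<dots> = seg 1 (n + 1) (c + 2) (n + 1)" using row_XB[of "c + 1" n] that assms by (simp add: numeral_eq_Suc)
    moreover have "row \<dots> = seg 0 0 1 (c + 2)" by (rule row_TX_end) (use that assms in auto)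
    ultimately show ?thesis by (simp only: funpow_3)
  qed
qed

text \<open>In each case the second step produces a top row that starts at the left wall.\<close>

lemma T_after_2:
  assumes "1 \<le> c" "c < d" "d \<le> n + 1" "\<not> (c = 1 \<and> d = n + 1)"
  shows "\<not> empty_row 2 ((row ^^ 2) (seg c d 0 0))"
proof -
  consider "d = n + 1" | "d = n" | "d < n" using assms(3) by linarith
  then show ?thesis
  proof cases
    case 1
    have "row (seg c d 0 0) = seg 1 c 1 (n + 1)" unfolding 1 by (rule row_T_end) (use assms 1 in auto)
    moreover have "row \<dots> = seg 1 (c + 1) (1 + 1) (c + 1)" by (rule row_XB) (use assms 1 in auto)
    ultimately show ?thesis using assms by (simp add: funpow_2)
  next
    case 2
    have "row (seg c d 0 0) = seg (c + 1) (n + 1) (c + 1) (n + 1)" unfolding 2 by (rule row_T) (use assms 2 in auto)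
    moreover have "row \<dots> = seg 1 (c + 1) 1 (c + 1)" by (rule row_XB_end) (use assms 2 in auto)
    ultimately show ?thesis using assms by (simp add: funpow_2)
  next
    case 3
    have "row (seg c d 0 0) = seg (c + 1) (d + 1) (c + 1) (n + 1)" by (rule row_T) (use assms 3 in auto)
    moreover have "row \<dots> = seg 1 (d + 1 + 1) (c + 1 + 1) (d + 1 + 1)" by (rule row_XB) (use assms 3 in auto)
    ultimately show ?thesis using assms by (simp add: funpow_2)
  qed
qed

text \<open>The return times from \<open>[x, y)\<close> to the next two \<open>B\<close>-states are \<open>n + 5 - y\<close> and \<open>y + 1\<close>, which add up to
  \<open>n + 6\<close>. So after \<open>n + 5\<close> steps the orbit sits just before a \<open>B\<close>-state, where the top row is nonempty.
  In the cases \<open>wall\<close>, \<open>corner\<close> and \<open>small\<close> one of the two returns is irregular.\<close>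

lemma short_B_not_periodic:
  assumes "odd n" "n \<noteq> 1" "1 \<le> x" "x < y" "y \<le> x + 3" "y \<le> n + 1"
  shows "(row ^^ (n + 5)) (seg 0 0 x y) \<noteq> seg 0 0 x y"
proof -
  have n3: "3 \<le> n" using assms(1,2) by presburger
  \<comment> \<open>From this corner the top row becomes full, which inserts an extra
    \<open>B\<close>-state, the full bottom row.\<close>
  have wall_3: "(row ^^ 3) (seg 0 0 n (n + 1)) = seg 1 2 0 0"
  proof -
    have "row (seg 0 0 n (n + 1)) = seg 1 (n + 1) 0 0" by (rule row_B_end) (use n3 in auto)
    moreover have "row \<dots> = seg 0 0 1 (n + 1)" by (rule row_T_full) (use n3 in auto)
    moreover have "row \<dots> = seg 1 2 0 0" using row_B_end[of 1] n3 by (simp add: numeral_eq_Suc)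
    ultimately show ?thesis by (simp only: funpow_3)
  qed
  \<comment> \<open>The next \<open>B\<close>-state is \<open>[x', n + 4 - y)\<close>, after
    \<open>(n + 2 - y) + 3\<close> steps. Another \<open>y - 2\<close> steps lead to a
    \<open>T\<close>-state and two more make \<open>n + 5\<close>. The last condition keeps that
    \<open>T\<close>-state from being the full top row.\<close>
  have main: ?thesis if "(row ^^ 3) (seg (n + 2 - y) (x + (n + 2 - y)) 0 0) = seg 0 0 x' (n + 4 - y)"
    "1 \<le> x'" "x' + y \<le> n + 3" "3 \<le> y" "\<not> (y = 3 \<and> x' = n)" for x'
  proof -
    have "(row ^^ (n + 2 - y)) (seg 0 0 x y) = seg (n + 2 - y) (x + (n + 2 - y)) 0 0"
      using B_to_T[of x y "n + 2 - y"] assms by simp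
    from this that(1) have "(row ^^ (n + 5 - y)) (seg 0 0 x y) = seg 0 0 x' (n + 4 - y)"
      by (rule funpow_trans) (use assms in simp)
    moreover have "(row ^^ (y - 2)) (seg 0 0 x' (n + 4 - y)) = seg (y - 2) (x' + (y - 2)) 0 0"
      using B_to_T[of x' "n + 4 - y" "y - 2"] that assms by simp
    ultimately have "(row ^^ (n + 3)) (seg 0 0 x y) = seg (y - 2) (x' + (y - 2)) 0 0"
      by (rule funpow_trans) (use assms that in simp)
    then have "(row ^^ (n + 5)) (seg 0 0 x y) = (row ^^ 2) (seg (y - 2) (x' + (y - 2)) 0 0)"
      by (rule funpow_trans[OF _ refl]) simp
    moreover have "\<not> empty_row 2 \<dots>"
      by (rule T_after_2) (use assms that in auto)
    moreover have "empty_row 2 (seg 0 0 x y)" by simp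
    ultimately show ?thesis by metis
  qed
  \<comment> \<open>Exceptions to \<open>main\<close>: in \<open>wall\<close> the first
    \<open>T\<close>-state is the full top row, in \<open>corner\<close> the bound
    \<open>3 \<le> y\<close> fails, and in \<open>small\<close> the second \<open>T\<close>-state is
    full.\<close>
  consider (wall) "x = n" "y = n + 1" | (corner) "x = 1" "y = 2"
    | (small) "n = 3" "x = 2" "y = 3"
    | (one) "y = x + 1" "2 \<le> x" "x < n" "\<not> (y = 3 \<and> n = 3)" | (two) "y = x + 2" | (three) "y = x + 3"
    using assms(3-6) by (cases "y = x + 1"; cases "y = x + 2"; cases "x = n"; cases "x = 1"; cases "x = 2 \<and> n = 3") auto
  then show ?thesis
  proof cases
    case one
    then show ?thesis
      using T_to_B(1)[of "n + 2 - y"] assms by (intro main[of 3]) (auto simp: Suc_diff_le)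
  next
    case two
    then show ?thesis
      using T_to_B(2)[of "n + 2 - y"] assms n3 by (intro main[of 2]) (auto simp: Suc_diff_le)
  next
    case three
    have eqs: "x + (n + 2 - y) = n - 1" "(n + 2 - y) + 2 = n + 4 - y" using three assms by auto
    show ?thesis
      by (rule main[of 1])
        (use T_to_B(3)[of "n + 2 - y", unfolded eqs] eqs three assms n3 in auto)
  next
    case wall
    note wall_3
    moreover have "\<not> empty_row 2 ((row ^^ (n + 2)) (seg 1 2 0 0))"
    proof (cases "n = 3")
      case True
      have "(row ^^ 3) (seg 1 2 0 0) = seg 0 0 1 3"
        using T_to_B(3)[of 1] True by (simp add: numeral_eq_Suc)
      moreover have "(row ^^ 2) (seg 0 0 1 3) = seg 2 3 0 0"
        using B_to_T[of 1 3 2] True by (simp add: numeral_3_eq_3)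
      ultimately have "(row ^^ (n + 2)) (seg 1 2 0 0) = seg 2 3 0 0"
        by (rule funpow_trans) (use True in simp)
      then show ?thesis by simp
    next
      case False
      then have n5: "5 \<le> n" using n3 \<open>odd n\<close> by presburger
      have "(row ^^ 3) (seg 1 2 0 0) = seg 0 0 4 5"
      proof -
        have "row (seg 1 2 0 0) = seg 2 3 2 (n + 1)" using row_T[of 1 2] n5 by (simp add: numeral_eq_Suc)
        moreover have "row \<dots> = seg 1 4 3 4" using row_XB[of 2 3] n5 by (simp add: numeral_eq_Suc)
        moreover have "row \<dots> = seg 0 0 4 5" using row_TX[of 3 4] n5 by (simp add: numeral_eq_Suc)
        ultimately show ?thesis by (simp only: funpow_3)
      qed
      moreover have "(row ^^ (n - 3)) (seg 0 0 4 5) = seg (n - 3) (n + 1) 0 0"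
        using B_to_T[of 4 5 "n - 3"] n5 by simp
      ultimately have "(row ^^ n) (seg 1 2 0 0) = seg (n - 3) (n + 1) 0 0"
        by (rule funpow_trans) (use n5 in simp)
      then have "(row ^^ (n + 2)) (seg 1 2 0 0) = (row ^^ 2) (seg (n - 3) (n + 1) 0 0)"
        by (rule funpow_trans[OF _ refl]) simp
      then show ?thesis using T_after_2[of "n - 3" "n + 1"] n5 by simp
    qed
    ultimately have "\<not> empty_row 2 ((row ^^ (n + 5)) (seg 0 0 x y))"
      unfolding wall using funpow_trans[of 3 row _ _ "n + 2" _ "n + 5"] by force
    moreover have "empty_row 2 (seg 0 0 x y)" by simp
    ultimately show ?thesis by metis
  next
    case corner
    have "(row ^^ n) (seg 0 0 1 2) = seg n (n + 1) 0 0"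
      using B_to_T[of 1 2 n] n3 by simp
    moreover have "(row ^^ 3) (seg n (n + 1) 0 0) = seg 0 0 1 2"
    proof -
      have "row (seg n (n + 1) 0 0) = seg 1 n 1 (n + 1)" by (rule row_T_end) (use n3 in auto)
      moreover have "row \<dots> = seg 1 (n + 1) 2 (n + 1)" using row_XB[of 1 n] n3 by (simp add: numeral_eq_Suc)
      moreover have "row \<dots> = seg 0 0 1 2" by (rule row_TX_end) (use n3 in auto)
      ultimately show ?thesis by (simp only: funpow_3)
    qed
    \<comment> \<open>Here \<open>n + 3\<close> is a period, so \<open>n + 5\<close> steps amount to
      two.\<close>
    ultimately have "(row ^^ (n + 3)) (seg 0 0 1 2) = seg 0 0 1 2" by (rule funpow_trans) simp
    moreover have "(row ^^ 2) (seg 0 0 1 2) = seg 2 3 3 4"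
      using row_B[of 1 2] row_TB[of 1 2 3] n3 by (simp add: numeral_eq_Suc)
    ultimately have "(row ^^ (n + 5)) (seg 0 0 1 2) = seg 2 3 3 4" by (rule funpow_trans) simp
    moreover have "empty_row 2 (seg 0 0 x y)" "\<not> empty_row 2 (seg 2 3 3 4)" by simp_all
    ultimately show ?thesis unfolding corner by metis
  next
    case small
    have "(row ^^ 2) (seg 0 0 2 3) = seg 2 4 0 0"
      using B_to_T[of 2 3 2] small by simp
    moreover have "(row ^^ 3) (seg 2 4 0 0) = seg 0 0 3 4" using T_to_B(1)[of 2] small by (simp add: numeral_eq_Suc)
    ultimately have "(row ^^ 5) (seg 0 0 2 3) = seg 0 0 3 4" by (rule funpow_trans) simp
    moreover have "(row ^^ 3) (seg 0 0 3 4) = seg 1 2 0 0" using wall_3 by (simp add: small(1))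
    ultimately have "(row ^^ (n + 5)) (seg 0 0 2 3) = seg 1 2 0 0"
      by (rule funpow_trans) (simp add: small)
    moreover have "empty_row 2 (seg 0 0 x y)" "\<not> empty_row 2 (seg 1 2 0 0)" by simp_all
    ultimately show ?thesis unfolding small(2,3) by metis
  qed
qed

section \<open>Reaching a \<open>B\<close>-state from the types that are not loose\<close>

definition reaches_B :: "(nat \<times> nat) set \<Rightarrow> bool" where
  "reaches_B S \<longleftrightarrow> (\<exists>k x y. (row ^^ k) S = seg 0 0 x y \<and> 1 \<le> x \<and> x < y \<and> y \<le> n + 1)"

lemma reaches_B_refl: "1 \<le> x \<Longrightarrow> x < y \<Longrightarrow> y \<le> n + 1 \<Longrightarrow> reaches_B (seg 0 0 x y)"
  unfolding reaches_B_def by (rule exI[of _ 0], rule exI[of _ x], rule exI[of _ y]) simp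

lemma reaches_B_step: "row S = S' \<Longrightarrow> reaches_B S' \<Longrightarrow> reaches_B S"
  unfolding reaches_B_def by (metis comp_apply funpow_Suc_right)

text \<open>The types follow each other as \<open>TB\<close>, \<open>T\<close>, \<open>XB\<close>,
  \<open>TX\<close>, \<open>B\<close>, with a shortcut at the full top row; the lemmas go backwards
  along this order. The excluded set is the whole poset, which alternates with the empty
  set.\<close>

lemma reaches_B_TX:
  assumes "1 \<le> a" "a < d" "d \<le> n + 1" "\<not> (a = 1 \<and> d = n + 1)"
  shows "reaches_B (seg 1 d a d)"
proof (cases "d = n + 1")
  case True
  show ?thesis unfolding True
    by (rule reaches_B_step[OF row_TX_end]; (rule reaches_B_refl)?) (use assms True in auto)
next
  case False
  show ?thesis
    by (rule reaches_B_step[OF row_TX]; (rule reaches_B_refl)?) (use assms False in auto)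
qed

lemma reaches_B_XB:
  assumes "1 \<le> c" "c < d" "d \<le> n + 1" "\<not> (c = 1 \<and> d = n + 1)"
  shows "reaches_B (seg c d c (n + 1))"
proof (cases "d = n + 1")
  case True
  show ?thesis unfolding True
    by (rule reaches_B_step[OF row_XB_end]; (rule reaches_B_TX)?) (use assms True in auto)
next
  case False
  show ?thesis
    by (rule reaches_B_step[OF row_XB]; (rule reaches_B_TX)?) (use assms False in auto)
qed

lemma reaches_B_T:
  assumes "1 \<le> c" "c < d" "d \<le> n + 1"
  shows "reaches_B (seg c d 0 0)"
proof -
  consider "d = n + 1" "c = 1" | "d = n + 1" "1 < c" | "d \<le> n" using assms by linarith
  then show ?thesis
  proof cases
    case 1
    show ?thesis unfolding 1
      by (rule reaches_B_step[OF row_T_full]; (rule reaches_B_refl)?) (use assms 1 in auto)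
  next
    case 2
    show ?thesis unfolding 2(1)
      by (rule reaches_B_step[OF row_T_end]; (rule reaches_B_XB)?) (use assms 2 in auto)
  next
    case 3
    show ?thesis
      by (rule reaches_B_step[OF row_T]; (rule reaches_B_XB)?) (use assms 3 in auto)
  qed
qed

lemma reaches_B_TB:
  assumes "1 \<le> c" "c < a" "a < b" "b \<le> n + 1"
  shows "reaches_B (seg c a a b)"
  using assms
proof (induction "n + 1 - b" arbitrary: a b c)
  case 0
  then have b: "b = n + 1" by simp
  show ?case unfolding b
    by (rule reaches_B_step[OF row_TB_end]; (rule reaches_B_T)?) (use 0 b in auto)
next
  case (Suc m)
  have "reaches_B (seg (c + 1) (a + 1) (a + 1) (b + 1))"
    by (rule Suc.hyps(1)) (use Suc in auto)
  then show ?case using row_TB[of c a b] Suc by (intro reaches_B_step[of "seg c a a b"]) auto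
qed

end

section \<open>Classification of interval-closed sets by their rows\<close>

lemma convex_nat_set_eq:
  fixes A :: "nat set"
  assumes "A \<subseteq> {1..n}" "A \<noteq> {}" "\<And>i j k. i \<in> A \<Longrightarrow> k \<in> A \<Longrightarrow> i \<le> j \<Longrightarrow> j \<le> k \<Longrightarrow> j \<in> A"
  obtains c d where "A = {c..<d}" "1 \<le> c" "c < d" "d \<le> n + 1"
proof
  have fin: "finite A" using assms(1) finite_subset by blast
  note m = Min_in[OF fin assms(2)] Max_in[OF fin assms(2)]
  have le: "Min A \<le> j" "j \<le> Max A" if "j \<in> A" for j using that fin by auto
  show "A = {Min A..<Suc (Max A)}" using le assms(3)[OF m] by (auto simp: less_Suc_eq_le)
  show "1 \<le> Min A" "Min A < Suc (Max A)" "Suc (Max A) \<le> n + 1" using m assms(1) le(1)[OF m(2)] by auto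
qed

lemma row_cases:
  assumes "interval_closed (two_by n) S" "i = 1 \<or> i = 2"
  shows "{j. (i, j) \<in> S} = {} \<or> (\<exists>c d. {j. (i, j) \<in> S} = {c..<d} \<and> 1 \<le> c \<and> c < d \<and> d \<le> n + 1)"
proof (cases "{j. (i, j) \<in> S} = {}")
  case False
  have S: "S \<subseteq> two_by n" "\<And>x y z. x \<in> S \<Longrightarrow> y \<in> S \<Longrightarrow> z \<in> two_by n \<Longrightarrow> x \<le> z \<Longrightarrow> z \<le> y \<Longrightarrow> z \<in> S"
    using assms(1) unfolding interval_closed_def by blast+
  have sub: "{j. (i, j) \<in> S} \<subseteq> {1..n}" using S(1) by (auto simp: two_by_def)
  have between: "(i, j) \<in> S" if "(i, k) \<in> S" "(i, l) \<in> S" "k \<le> j" "j \<le> l" for j k l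
  proof -
    have "1 \<le> k" "l \<le> n" using subsetD[OF sub, of k] subsetD[OF sub, of l] that by simp_all
    then have "(i, j) \<in> two_by n" using that(3,4) assms(2) by (auto simp: two_by_def)
    then show ?thesis using S(2)[OF that(1,2)] that(3,4) by simp
  qed
  have convex: "j \<in> {j. (i, j) \<in> S}" if "k \<in> {j. (i, j) \<in> S}" "l \<in> {j. (i, j) \<in> S}" "k \<le> j" "j \<le> l" for j k l
    using between[where k = k and l = l and j = j] that by simp
  obtain c d where "{j. (i, j) \<in> S} = {c..<d}" "1 \<le> c" "c < d" "d \<le> n + 1"
    by (rule convex_nat_set_eq[OF sub False convex])
  then show ?thesis by blast
qed simp

lemma interval_closed_two_by_cases:
  assumes "interval_closed (two_by n) S"
  obtains "S = {}"
  | c d where "S = seg c d 0 0" "1 \<le> c" "c < d" "d \<le> n + 1"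
  | a b where "S = seg 0 0 a b" "1 \<le> a" "a < b" "b \<le> n + 1"
  | c d a b where "S = seg c d a b" "1 \<le> c" "c < d" "d \<le> n + 1" "1 \<le> a" "a < b" "b \<le> n + 1"
    "d \<le> a \<or> c \<le> a \<and> d \<le> b"
proof -
  have S: "S \<subseteq> two_by n" "\<And>x y z. x \<in> S \<Longrightarrow> y \<in> S \<Longrightarrow> z \<in> two_by n \<Longrightarrow> x \<le> z \<Longrightarrow> z \<le> y \<Longrightarrow> z \<in> S"
    using assms unfolding interval_closed_def by blast+
  have rows: "S = seg c d a b" if "{j. (2, j) \<in> S} = {c..<d}" "{j. (1, j) \<in> S} = {a..<b}" for c d a b
  proof -
    have "(2, j) \<in> S \<longleftrightarrow> c \<le> j \<and> j < d" "(1, j) \<in> S \<longleftrightarrow> a \<le> j \<and> j < b" for j using that by auto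
    then show ?thesis using S(1) by (auto simp: seg_def two_by_def)
  qed
  have empty: "{j. (i, j) \<in> S} = {0..<0}" if "{j. (i, j) \<in> S} = {}" for i using that by simp
  consider (empty) "{j. (2, j) \<in> S} = {}" "{j. (1, j) \<in> S} = {}"
    | (T) c d where "{j. (2, j) \<in> S} = {c..<d}" "1 \<le> c" "c < d" "d \<le> n + 1" "{j. (1, j) \<in> S} = {}"
    | (B) a b where "{j. (1, j) \<in> S} = {a..<b}" "1 \<le> a" "a < b" "b \<le> n + 1" "{j. (2, j) \<in> S} = {}"
    | (both) c d a b where "{j. (2, j) \<in> S} = {c..<d}" "1 \<le> c" "c < d" "d \<le> n + 1"
      "{j. (1, j) \<in> S} = {a..<b}" "1 \<le> a" "a < b" "b \<le> n + 1"
    using row_cases[OF assms, of 1] row_cases[OF assms, of 2] by blast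
  then show ?thesis
  proof cases
    case empty
    then have "S = {}" using S(1) by (auto simp: two_by_def)
    then show ?thesis by (rule that(1))
  next
    case T
    then show ?thesis using that(2)[OF rows[OF T(1) empty[OF T(5)]]] by blast
  next
    case B
    then show ?thesis using that(3)[OF rows[OF empty[OF B(5)] B(1)]] by blast
  next
    case both
    have eq: "S = seg c d a b" using both by (intro rows)
    \<comment> \<open>Now \<open>(1, a)\<close> lies below \<open>(2, d - 1)\<close>, and the other
      two corners \<open>(2, a)\<close> and \<open>(1, d - 1)\<close> of the rectangle they span
      must belong to \<open>S\<close>.\<close>
    have "c \<le> a \<and> d \<le> b" if "a < d"
    proof -
      have "(1, a) \<in> S" "(2, d - 1) \<in> S" using eq both by auto
      note between = S(2)[OF this]
      have "(2, a) \<in> S" "(1, d - 1) \<in> S"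
        using between[of "(2, a)"] between[of "(1, d - 1)"] that both by (auto simp: two_by_def)
      then show ?thesis using eq by auto
    qed
    then have "d \<le> a \<or> c \<le> a \<and> d \<le> b" by linarith
    with both show ?thesis by (intro that(4)[OF eq])
  qed
qed

context two_by_rowmotion
begin

lemma loose_or_reaches_B:
  assumes "interval_closed (two_by n) S" "S \<noteq> {}" "S \<noteq> seg 1 (n + 1) 1 (n + 1)" "\<not> loose n S"
  shows "reaches_B S"
  using assms(1)
proof (cases rule: interval_closed_two_by_cases)
  case (4 c d a b)
  \<comment> \<open>With both rows nonempty, failure of \<open>loose\<close> leaves exactly the
    types \<open>TB\<close>, \<open>TX\<close> and \<open>XB\<close>.\<close>
  consider "d = a" | "c = 1" "d = b" "a < d" | "c = a" "b = n + 1"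
    using looseI[of c d a b n] 4 assms(4) by (metis linorder_neqE_nat not_le)
  then show ?thesis
  proof cases
    case 1
    then show ?thesis using 4 reaches_B_TB by simp
  next
    case 2
    then have "\<not> (a = 1 \<and> d = n + 1)" using 4 assms(3) by auto
    then show ?thesis using reaches_B_TX[of a d] 4 2 by simp
  next
    case 3
    then have "\<not> (c = 1 \<and> d = n + 1)" using 4 assms(3) by auto
    then show ?thesis using reaches_B_XB[of c d] 4 3 by simp
  qed
qed (use assms reaches_B_T reaches_B_refl in auto)

end

text \<open>The potential only needs the right increment on a family \<open>Q\<close> preserved
  along the orbit. The factor \<open>m\<close> allows integer potentials.\<close>

lemma sum_orbit_invariant:
  fixes F g :: "'a \<Rightarrow> int"
  assumes self: "x \<in> orbit f x" and "Q x" and "m \<noteq> 0"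
    and step: "\<And>y. y \<in> orbit f x \<Longrightarrow> Q y \<Longrightarrow> Q (f y) \<and> F (f y) - F y = m * g y"
  shows "(\<Sum>y\<in>orbit f x. g y) = 0"
proof -
  have "Q y" if "y \<in> orbit f x" for y
    using that by induction (use step self \<open>Q x\<close> in blast)+
  then have "(\<Sum>y\<in>orbit f x. m * g y) = 0"
    using step by (intro sum_orbit_telescope[OF self, where F = F]) blast
  then show ?thesis using \<open>m \<noteq> 0\<close> by (simp flip: sum_distrib_left)
qed

lemma funpow_dvd:
  assumes "(f ^^ p) x = x" "p dvd m"
  shows "(f ^^ m) x = x"
proof -
  obtain k where m: "m = k * p" using assms(2) by (metis dvdE mult.commute)
  have "(f ^^ (k * p)) x = x" using assms(1) by (induction k) (simp_all add: funpow_add)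
  then show ?thesis unfolding m .
qed

section \<open>Vanishing of the orbit sums, family by family\<close>

context two_by_rowmotion
begin

lemma self_in_orbit_row:
  assumes "interval_closed (two_by n) S"
  shows "S \<in> orbit row S"
proof (rule self_in_orbit_if_inj_on)
  show "finite {I. interval_closed (two_by n) I}"
    by (rule finite_subset[of _ "Pow (two_by n)"]) (auto simp: interval_closed_def two_by_def)
  show "row ` {I. interval_closed (two_by n) I} \<subseteq> {I. interval_closed (two_by n) I}"
    using interval_closed_rowmotion by blast
qed (use inj_on_rowmotion assms in auto)

lemma orbit_row_closed:
  assumes "interval_closed (two_by n) S" "S' \<in> orbit row S"
  shows "interval_closed (two_by n) S'" "orbit row S' = orbit row S"
proof -
  show "interval_closed (two_by n) S'"
    using assms(2) by induction (use assms(1) interval_closed_rowmotion in blast)+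
  have "cyclic_on row (orbit row S)"
    unfolding cyclic_on_def using self_in_orbit_row[OF assms(1)] by blast
  then show "orbit row S' = orbit row S" using assms(2) by (rule orbit_cyclic_eq3)
qed

text \<open>The empty and the full set are exchanged, and both have signed cardinality 0, so a
  constant potential works.\<close>

lemma sum_orbit_trivial:
  assumes "S = {} \<or> S = seg 1 (n + 1) 1 (n + 1)" "interval_closed (two_by n) S"
  shows "(\<Sum>I\<in>orbit row S. signed_card I) = 0"
proof (rule sum_orbit_invariant[where F = "\<lambda>_. 0" and m = 2
      and Q = "\<lambda>S. S = {} \<or> S = seg 1 (n + 1) 1 (n + 1)"])
  have empty: "seg 0 0 0 0 = {}" by (simp add: seg_def)
  show "(row I = {} \<or> row I = seg 1 (n + 1) 1 (n + 1)) \<and> 0 - 0 = 2 * signed_card I"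
    if "I = {} \<or> I = seg 1 (n + 1) 1 (n + 1)" for I
    using that row_empty row_all signed_card_seg[of 1 "n + 1" 1 "n + 1"]
    unfolding empty by (auto simp: signed_card_def)
qed (use assms self_in_orbit_row in auto)

lemma sum_orbit_loose:
  assumes "odd n" "loose n S" "interval_closed (two_by n) S"
  shows "(\<Sum>I\<in>orbit row S. signed_card I) = 0"
  by (rule sum_orbit_invariant[where F = loose_potential and m = 4 and Q = "loose n"])
    (use assms self_in_orbit_row loose_step in auto)

text \<open>For \<open>n = 1\<close> the poset is a two-element chain and this orbit has period 2, a
  divisor of \<open>n + 5 = 6\<close>; the non-periodicity of short \<open>B\<close>-states fails
  here.\<close>

lemma sum_orbit_singleton_chain:
  assumes "n = 1"
  shows "(\<Sum>I\<in>orbit row (seg 0 0 1 2). signed_card I) = 0"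
proof (rule sum_orbit_invariant[where F = "\<lambda>S. if empty_row 2 S then 0 else 2" and m = 2
      and Q = "\<lambda>S. S = seg 0 0 1 2 \<or> S = seg 1 2 0 0"])
  have "interval_closed (two_by n) (seg 0 0 1 2)"
    using assms by (intro interval_closed_seg) auto
  then show "seg 0 0 1 2 \<in> orbit row (seg 0 0 1 2)" by (rule self_in_orbit_row)
  have "row (seg 0 0 1 2) = seg 1 2 0 0" "row (seg 1 2 0 0) = seg 0 0 1 2"
    using row_B_end[of 1] row_T_full assms by (simp_all add: numeral_2_eq_2)
  moreover have "2 * signed_card (seg 0 0 1 2) = 2" "2 * signed_card (seg 1 2 0 0) = -2"
    using signed_card_seg[of 0 0 1 2] signed_card_seg[of 1 2 0 0] by simp_all
  ultimately show "(row I = seg 0 0 1 2 \<or> row I = seg 1 2 0 0) \<and>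
      (if empty_row 2 (row I) then 0 else 2) - (if empty_row 2 I then 0 else 2) = 2 * signed_card I"
    if "I = seg 0 0 1 2 \<or> I = seg 1 2 0 0" for I
    using that by auto
qed auto

lemma sum_orbit_B:
  assumes "odd n" "1 \<le> x" "x < y" "y \<le> n + 1" "card (orbit row (seg 0 0 x y)) dvd n + 5"
  shows "(\<Sum>I\<in>orbit row (seg 0 0 x y). signed_card I) = 0"
proof (cases "n = 1")
  case True
  then have "x = 1" "y = 2" using assms by auto
  then show ?thesis using sum_orbit_singleton_chain True by simp
next
  case False
  let ?S = "seg 0 0 x y"
  have ics: "interval_closed (two_by n) ?S" using assms by (intro interval_closed_seg) auto
  \<comment> \<open>The orbit size divides \<open>n + 5\<close>, which is therefore a period of
    every \<open>B\<close>-state in the orbit. Short ones are excluded by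
    \<open>short_B_not_periodic\<close>.\<close>
  have long: "a + 4 \<le> b" if "seg 0 0 a b \<in> orbit row ?S" "a < b" for a b
  proof (rule ccontr)
    let ?I = "seg 0 0 a b"
    assume "\<not> a + 4 \<le> b"
    have I: "interval_closed (two_by n) ?I" using orbit_row_closed(1)[OF ics that(1)] .
    then have "1 \<le> a" "b \<le> n + 1"
      using that(2) seg_subset_two_by_iff[of 0 0 a b n] unfolding interval_closed_def by auto
    then have "(row ^^ (n + 5)) ?I \<noteq> ?I"
      using short_B_not_periodic[of a b] assms(1) False that(2) \<open>\<not> a + 4 \<le> b\<close> by simp
    moreover have "(row ^^ (n + 5)) ?I = ?I"
      using funpow_dvd[OF funpow_card_orbit[OF self_in_orbit_row[OF I]]] assms(5)
      unfolding orbit_row_closed(2)[OF ics that(1)] by blast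
    ultimately show False by simp
  qed
  show ?thesis
  proof (rule sum_orbit_invariant[where F = "tight_potential n" and m = 4 and Q = "generic n"])
    show self: "?S \<in> orbit row ?S" by (rule self_in_orbit_row[OF ics])
    show "generic n ?S" using long[OF self] assms by (intro generic.B) auto
    show "generic n (row I) \<and> tight_potential n (row I) - tight_potential n I = 4 * signed_card I"
      if "I \<in> orbit row ?S" "generic n I" for I
      by (rule generic_step[OF assms(1) that(2)]) (use long orbit.step[OF that(1)] in metis)
  qed simp
qed

lemma sum_orbit_eq_0:
  assumes "odd n" "interval_closed (two_by n) S" "card (orbit row S) dvd n + 5"
  shows "(\<Sum>I\<in>orbit row S. signed_card I) = 0"
proof -
  consider "S = {} \<or> S = seg 1 (n + 1) 1 (n + 1)" | "loose n S" | "reaches_B S"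
    using loose_or_reaches_B[OF assms(2)] by blast
  then show ?thesis
  proof cases
    case 3
    then obtain k x y where xy: "(row ^^ k) S = seg 0 0 x y" "1 \<le> x" "x < y" "y \<le> n + 1"
      unfolding reaches_B_def by blast
    \<comment> \<open>The sum depends only on the orbit, so the base point may be moved to the
      \<open>B\<close>-state.\<close>
    have "seg 0 0 x y \<in> orbit row S"
      unfolding xy(1)[symmetric] using self_in_orbit_row[OF assms(2)] by (rule funpow_in_orbit)
    then have "orbit row (seg 0 0 x y) = orbit row S" by (rule orbit_row_closed(2)[OF assms(2)])
    then show ?thesis using sum_orbit_B[OF assms(1) xy(2-4)] assms(3) by simp
  qed (use assms sum_orbit_trivial sum_orbit_loose in auto)
qed

end

theorem theorem3p19:
  fixes n :: nat and xs :: "(nat \<times> nat) list" and \<O> :: "(nat \<times> nat) set set"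
  assumes "odd n"
    and "linear_extension (two_by n) xs"
    and "\<O> \<in> rowmotion_orbits (two_by n) xs"
    and "real (card \<O>) = real n + 5 \<or> real (card \<O>) = (real n + 5) / 3"
  shows "1 / real (card \<O>) * (\<Sum>I\<in>\<O>. real_of_int (signed_card I)) = 0"
proof -
  interpret two_by_rowmotion n xs by standard (fact assms(2))
  obtain S where S: "interval_closed (two_by n) S" "\<O> = orbit row S"
    using assms(3) unfolding rowmotion_orbits_def by blast
  \<comment> \<open>Clearing the denominator moves both alternatives to natural numbers, where each
    says that the orbit size divides \<open>n + 5\<close>.\<close>
  have "real (card \<O>) = real (n + 5) \<or> real (3 * card \<O>) = real (n + 5)" using assms(4) by auto
  then have "card \<O> = n + 5 \<or> 3 * card \<O> = n + 5" unfolding of_nat_eq_iff .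
  then have "card \<O> dvd n + 5" by (metis dvd_refl dvd_triv_right)
  then have "(\<Sum>I\<in>\<O>. signed_card I) = 0" using sum_orbit_eq_0 assms(1) S by blast
  then have "(\<Sum>I\<in>\<O>. real_of_int (signed_card I)) = 0" by (simp flip: of_int_sum)
  then show ?thesis by simp
qed

end
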